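(* Consider a function $g\in L^2(\mathbb{R},\gamma)$ with expansion $g(x)=\sum_{q=0}^\infty c_qH_q(x)$ (convergent in $L^2(\mathbb{R},\gamma)$). Suppose that $c_q\ge 0$ for each $q\ge 0$ and that $g\in L^{2M}(\mathbb{R},\gamma)$ for some integer $M\ge 1$. For $N\ge0$ consider the truncated sequence $g^{(N)}:=\sum_{q=0}^N c_qH_q$. Then $(g^{(N)})^M$ converges in $L^2(\mathbb{R},\gamma)$ to $g^M$ as $N\to\infty$.
   Context: $\gamma$ is the standard Gaussian measure on $\mathbb{R}$. $H_q$ is the $q$-th Hermite polynomial: $H_0=1$ and $H_q(x)=(-1)^q e^{x^2/2}\frac{d^q}{dx^q}e^{-x^2/2}$ for $q\ge 1$. *)

theory Defs
  imports "HOL-Probability.Probability"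
begin

definition gauss_measure :: "real measure" where
  "gauss_measure = density lborel (\<lambda>x. ennreal (std_normal_density x))"

definition hermite :: "nat \<Rightarrow> real \<Rightarrow> real" where
  "hermite q x = (-1) ^ q * exp (x\<^sup>2 / 2) * (deriv ^^ q) (\<lambda>t. exp (- t\<^sup>2 / 2)) x"

lemma hermite_0: "hermite 0 x = 1"
  by (simp add: hermite_def exp_minus)

definition hermite_sum :: "(nat \<Rightarrow> real) \<Rightarrow> nat \<Rightarrow> real \<Rightarrow> real" where
  "hermite_sum c N x = (\<Sum>q\<le>N. c q * hermite q x)"

(* L^p for integer exponents p \<ge> 1, on the level of functions rather than of
   almost-everywhere classes. *)

definition Lp :: "nat \<Rightarrow> 'a measure \<Rightarrow> ('a \<Rightarrow> real) set" where
  "Lp p \<mu> = {f \<in> borel_measurable \<mu>. integrable \<mu> (\<lambda>x. \<bar>f x\<bar> ^ p)}"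

definition Lp_norm :: "nat \<Rightarrow> 'a measure \<Rightarrow> ('a \<Rightarrow> real) \<Rightarrow> real" where
  "Lp_norm p \<mu> f = root p (LINT x|\<mu>. \<bar>f x\<bar> ^ p)"

(* The membership conditions are part of the notion: without them the Bochner integral
   in the norm could be 0 by default for a non-integrable difference. *)
definition converges_in_Lp ::
    "nat \<Rightarrow> 'a measure \<Rightarrow> (nat \<Rightarrow> 'a \<Rightarrow> real) \<Rightarrow> ('a \<Rightarrow> real) \<Rightarrow> bool" where
  "converges_in_Lp p \<mu> F f \<longleftrightarrow>
     (\<forall>n. F n \<in> Lp p \<mu>) \<and> f \<in> Lp p \<mu> \<and>
     (\<lambda>n. Lp_norm p \<mu> (\<lambda>x. F n x - f x)) \<longlonglongrightarrow> 0"

end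

theory Submission
  imports Defs
begin

text \<open>
  Let \<open>P\<^sub>N\<close> be the truncation of \<open>g\<close> and \<open>K\<close> the cone of polynomials with nonnegative
  Hermite coefficients. \<open>K\<close> is closed under products and its elements have nonnegative Gaussian mean.
  Since \<open>P\<^sub>n - P\<^sub>N \<in> K\<close> for \<open>n \<ge> N\<close>, letting \<open>n \<rightarrow> \<infinity>\<close> gives \<open>E[(g - P\<^sub>N) p] \<ge> 0\<close> for all
  \<open>p \<in> K\<close>. With \<open>p = P\<^sub>N ^ (2 M - 1)\<close>, the tangent inequality for \<open>t ^ (2 M)\<close> yields
  \<open>e\<^sub>N = E[P\<^sub>N ^ (2 M)] \<le> E[g ^ (2 M)]\<close>. Positivity also gives
  \<open>E[(P\<^sub>n ^ M - P\<^sub>N ^ M)\<^sup>2] \<le> e\<^sub>n - e\<^sub>N\<close>, so \<open>e\<close> increases to a finite limit \<open>L\<close>, and Fatou's lemma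
  along an almost everywhere convergent subsequence bounds \<open>E[(P\<^sub>N ^ M - g ^ M)\<^sup>2]\<close> by \<open>L - e\<^sub>N\<close>.
\<close>

section \<open>Hermite polynomials\<close>

text \<open>The creation operator \<open>x - d/dx\<close>, adjoint to differentiation in the L2
  space of the Gaussian measure.\<close>

definition raising :: "real poly \<Rightarrow> real poly" where
  "raising p = [:0, 1:] * p - pderiv p"

primrec hermite_poly :: "nat \<Rightarrow> real poly" where
  "hermite_poly 0 = 1"
| "hermite_poly (Suc n) = raising (hermite_poly n)"

lemma raising_0 [simp]: "raising 0 = 0"
  by (simp add: raising_def)

lemma raising_add: "raising (p + q) = raising p + raising q"
  by (simp add: raising_def pderiv_add algebra_simps)

lemma raising_smult: "raising (smult a p) = smult a (raising p)"
  by (simp add: raising_def pderiv_smult smult_diff_right)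

lemma raising_mult: "raising p * q = raising (p * q) + p * pderiv q"
  by (simp add: raising_def pderiv_mult algebra_simps)

text \<open>The canonical commutation relation: the commutator of \<open>pderiv\<close> and
  \<open>raising\<close> is the identity.\<close>

lemma pderiv_raising: "pderiv (raising p) = p + raising (pderiv p)"
  by (simp add: raising_def pderiv_diff pderiv_mult pderiv_pCons)

lemma pderiv_hermite_poly_Suc:
  "pderiv (hermite_poly (Suc n)) = smult (real (Suc n)) (hermite_poly n)"
proof (induction n)
  case 0
  show ?case by (simp add: raising_def pderiv_pCons)
next
  case (Suc n)
  have "pderiv (hermite_poly (Suc (Suc n))) =
      hermite_poly (Suc n) + raising (pderiv (hermite_poly (Suc n)))"
    by (simp add: pderiv_raising)
  also have "\<dots> = hermite_poly (Suc n) + smult (real (Suc n)) (hermite_poly (Suc n))"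
    by (simp only: Suc.IH raising_smult hermite_poly.simps(2)[symmetric])
  also have "\<dots> = smult (real (Suc (Suc n))) (hermite_poly (Suc n))"
    by (simp only: of_nat_Suc[of "Suc n"] smult_add_left smult_1_left)
  finally show ?case .
qed

text \<open>Differentiating \<open>p(x) * exp (- x^2 / 2)\<close> replaces \<open>p\<close> by
  \<open>- raising p\<close>, so each derivative contributes one sign and one raising.\<close>

lemma deriv_iterate_gauss:
  "(deriv ^^ q) (\<lambda>t. exp (- t\<^sup>2 / 2)) =
     (\<lambda>x. (-1) ^ q * poly (hermite_poly q) x * exp (- x\<^sup>2 / 2))"
proof (induction q)
  case 0
  show ?case by simp
next
  case (Suc q)
  have "((\<lambda>x. (-1) ^ q * poly (hermite_poly q) x * exp (- x\<^sup>2 / 2)) has_field_derivative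
      (-1) ^ Suc q * poly (hermite_poly (Suc q)) x * exp (- x\<^sup>2 / 2)) (at x)" for x :: real
    by (auto intro!: derivative_eq_intros simp: raising_def algebra_simps)
  then show ?case
    unfolding funpow.simps o_apply Suc.IH by (intro ext DERIV_imp_deriv)
qed

lemma hermite_eq_poly: "hermite q x = poly (hermite_poly q) x"
proof -
  have "hermite q x = ((-1) ^ q * (-1) ^ q) * (exp (x\<^sup>2 / 2) * exp (- x\<^sup>2 / 2)) *
      poly (hermite_poly q) x"
    unfolding hermite_def deriv_iterate_gauss by (simp only: ac_simps)
  also have "((-1) ^ q * (-1) ^ q :: real) = 1"
    by (simp flip: power_mult_distrib)
  also have "exp (x\<^sup>2 / 2) * exp (- x\<^sup>2 / 2) = 1"
    by (simp flip: exp_add)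
  finally show ?thesis by simp
qed

section \<open>The cone of nonnegative Hermite coefficients\<close>

text \<open>Generated one term at a time, with repeated indices allowed, so that linear properties
  follow by induction without extracting Hermite coefficients.\<close>

inductive_set hermite_cone :: "real poly set" where
  zero: "0 \<in> hermite_cone"
| add_term: "p \<in> hermite_cone \<Longrightarrow> 0 \<le> a \<Longrightarrow> p + smult a (hermite_poly n) \<in> hermite_cone"

lemma hermite_cone_hermite_poly: "hermite_poly n \<in> hermite_cone"
  using hermite_cone.add_term[OF hermite_cone.zero, of 1 n] by simp

lemma hermite_cone_add:
  assumes "p \<in> hermite_cone" and "q \<in> hermite_cone"
  shows "p + q \<in> hermite_cone"
  using assms(2)
proof induction
  case zero
  then show ?case using assms(1) by simp
next
  case (add_term q a n)
  then show ?case
    using hermite_cone.add_term[of "p + q" a n] by (simp add: add.assoc)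
qed

lemma hermite_cone_smult:
  assumes "p \<in> hermite_cone" and "0 \<le> b"
  shows "smult b p \<in> hermite_cone"
  using assms(1)
proof induction
  case zero
  show ?case by (simp add: hermite_cone.zero)
next
  case (add_term p a n)
  then show ?case
    using hermite_cone.add_term[of "smult b p" "b * a" n] assms(2) by (simp add: smult_add_right)
qed

lemma hermite_cone_raising: "p \<in> hermite_cone \<Longrightarrow> raising p \<in> hermite_cone"
proof (induction rule: hermite_cone.induct)
  case zero
  show ?case by (simp add: hermite_cone.zero)
next
  case (add_term p a n)
  then show ?case
    using hermite_cone.add_term[of "raising p" a "Suc n"] by (simp add: raising_add raising_smult)
qed

text \<open>
  Instead of the linearization formula, the induction uses \<open>H\<^sub>m\<^sub>+\<^sub>1 H\<^sub>n = raising (H\<^sub>m H\<^sub>n) + n H\<^sub>m H\<^sub>n\<^sub>-\<^sub>1\<close>,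
  which, unlike the three-term recurrence, has no negative coefficients.
\<close>

lemma hermite_poly_mult_in_cone: "hermite_poly m * hermite_poly n \<in> hermite_cone"
proof (induction m arbitrary: n)
  case 0
  show ?case by (simp add: hermite_cone_hermite_poly)
next
  case (Suc m)
  have "hermite_poly m * pderiv (hermite_poly n) \<in> hermite_cone"
  proof (cases n)
    case 0
    then show ?thesis by (simp add: hermite_cone.zero)
  next
    case (Suc k)
    then show ?thesis
      using hermite_cone_smult[OF Suc.IH[of k], of "real (Suc k)"]
      by (simp only: pderiv_hermite_poly_Suc mult_smult_right of_nat_0_le_iff)
  qed
  then show ?case
    by (simp add: raising_mult hermite_cone_add hermite_cone_raising Suc.IH)
qed

lemma hermite_cone_mult:
  assumes "p \<in> hermite_cone" and "q \<in> hermite_cone"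
  shows "p * q \<in> hermite_cone"
proof -
  have *: "p * hermite_poly n \<in> hermite_cone" for n
    using assms(1)
  proof induction
    case zero
    show ?case by (simp add: hermite_cone.zero)
  next
    case (add_term p a m)
    then show ?case
      by (simp add: distrib_right hermite_cone_add hermite_cone_smult hermite_poly_mult_in_cone)
  qed
  show ?thesis
    using assms(2)
  proof induction
    case zero
    show ?case by (simp add: hermite_cone.zero)
  next
    case (add_term q a m)
    then show ?case
      by (simp add: distrib_left hermite_cone_add hermite_cone_smult *)
  qed
qed

lemma hermite_cone_power: "p \<in> hermite_cone \<Longrightarrow> p ^ k \<in> hermite_cone"
proof (induction k)
  case 0
  show ?case using hermite_cone_hermite_poly[of 0] by simp
next
  case (Suc k)
  then show ?case by (simp add: hermite_cone_mult)
qed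

lemma hermite_cone_sum:
  "(\<And>i. i \<in> A \<Longrightarrow> f i \<in> hermite_cone) \<Longrightarrow> sum f A \<in> hermite_cone"
  by (induction A rule: infinite_finite_induct)
     (auto intro: hermite_cone.zero hermite_cone_add)

text \<open>Since \<open>p = q + (p - q)\<close> also lies in the cone, \<open>p ^ k - q ^ k\<close>
  telescopes into sums of products of cone elements.\<close>

lemma hermite_cone_power_diff:
  assumes "q \<in> hermite_cone" and "p - q \<in> hermite_cone"
  shows "p ^ k - q ^ k \<in> hermite_cone"
proof -
  have p: "p \<in> hermite_cone"
    using hermite_cone_add[OF assms] by simp
  show ?thesis
  proof (induction k)
    case 0
    show ?case by (simp add: hermite_cone.zero)
  next
    case (Suc k)
    have "p ^ Suc k - q ^ Suc k = p * (p ^ k - q ^ k) + (p - q) * q ^ k"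
      by (simp add: algebra_simps)
    then show ?case
      using Suc p assms by (simp only:) (intro hermite_cone_add hermite_cone_mult hermite_cone_power)
  qed
qed

section \<open>Gaussian integrals\<close>

lemma sets_gauss_measure [measurable_cong, simp]: "sets gauss_measure = sets borel"
  by (simp add: gauss_measure_def)

lemma integrable_gauss_measure_iff:
  fixes f :: "real \<Rightarrow> real"
  assumes "f \<in> borel_measurable borel"
  shows "integrable gauss_measure f \<longleftrightarrow> integrable lborel (\<lambda>x. std_normal_density x * f x)"
  unfolding gauss_measure_def using assms by (subst integrable_real_density) auto

lemma integral_gauss_measure:
  fixes f :: "real \<Rightarrow> real"
  assumes "f \<in> borel_measurable borel"
  shows "(LINT x|gauss_measure. f x) = (LINT x|lborel. std_normal_density x * f x)"
  unfolding gauss_measure_def using assms by (subst integral_real_density) auto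

lemma borel_measurable_poly [measurable]: "poly (p :: real poly) \<in> borel_measurable borel"
  by (intro borel_measurable_continuous_onI continuous_on_poly continuous_on_id)

lemma integrable_gauss_power: "integrable gauss_measure (\<lambda>x. x ^ k :: real)"
  by (simp add: integrable_gauss_measure_iff integrable_std_normal_moment)

lemma integrable_gauss_poly [simp]: "integrable gauss_measure (poly p)"
proof -
  have "poly p = (\<lambda>x. \<Sum>i\<le>degree p. coeff p i * x ^ i)"
    by (simp add: poly_altdef fun_eq_iff)
  then show ?thesis
    by (simp add: integrable_gauss_power)
qed

section \<open>Moments, integration by parts and means of cone elements\<close>

lemma gauss_integral_odd: "(LINT x|gauss_measure. x ^ (2 * k + 1)) = (0 :: real)"
  using integral_std_normal_moment_odd[of k] by (simp add: integral_gauss_measure)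

lemma gauss_integral_even:
  "(LINT x|gauss_measure. x ^ (2 * k)) = (fact (2 * k) / (2 ^ k * fact k) :: real)"
  using integral_std_normal_moment_even[of k] by (simp add: integral_gauss_measure)

text \<open>Gaussian integration by parts \<open>E[x f] = E[f']\<close> for monomials, read off from
  the explicit moments.\<close>

lemma gauss_integral_power_Suc:
  "(LINT x|gauss_measure. x ^ Suc n) = real n * (LINT x|gauss_measure. x ^ (n - 1))"
proof (cases "even n")
  case True
  then obtain k where k: "n = 2 * k" by blast
  show ?thesis
  proof (cases k)
    \<comment> \<open>Here \<open>n - 1\<close> truncates to 0, but the factor \<open>real n\<close>
      makes the right side vanish.\<close>
    case 0
    then show ?thesis using k gauss_integral_odd[of 0] by simp
  next
    case (Suc j)
    have "n - 1 = 2 * j + 1" "Suc n = 2 * k + 1" using k Suc by auto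
    then show ?thesis using gauss_integral_odd[of j] gauss_integral_odd[of k] by simp
  qed
next
  case False
  then obtain k where k: "n = 2 * k + 1" by (rule oddE)
  have n: "n - 1 = 2 * k" "Suc n = 2 * Suc k" using k by auto
  have "(LINT x|gauss_measure. x ^ Suc n) = (fact (2 * Suc k) / (2 ^ Suc k * fact (Suc k)) :: real)"
    unfolding n(2) by (rule gauss_integral_even)
  also have "\<dots> = real n * (fact (2 * k) / (2 ^ k * fact k))"
    unfolding k by (simp add: field_simps del: of_nat_Suc) (simp add: algebra_simps)
  also have "\<dots> = real n * (LINT x|gauss_measure. x ^ (n - 1))"
    unfolding n(1) by (simp only: gauss_integral_even)
  finally show ?thesis .
qed

lemma gauss_integral_raising: "(LINT x|gauss_measure. poly (raising p) x) = 0"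
proof -
  have mono: "(LINT x|gauss_measure. poly (raising (monom 1 n)) x) = 0" for n
  proof -
    have "poly (raising (monom 1 n)) x = x ^ Suc n - real n * x ^ (n - 1)" for x
      by (simp add: raising_def pderiv_monom poly_monom)
    then show ?thesis
      using gauss_integral_power_Suc[of n]
      by (simp add: integrable_gauss_power del: power_Suc)
  qed
  have raising_sum: "raising (sum f A) = (\<Sum>i\<in>A. raising (f i))" for f and A :: "nat set"
    by (induction A rule: infinite_finite_induct) (auto simp: raising_add)
  have "raising p = raising (\<Sum>i\<le>degree p. smult (coeff p i) (monom 1 i))"
    by (simp add: smult_monom poly_as_sum_of_monoms)
  also have "\<dots> = (\<Sum>i\<le>degree p. smult (coeff p i) (raising (monom 1 i)))"
    by (simp add: raising_sum raising_smult)
  finally have "poly (raising p) x = (\<Sum>i\<le>degree p. coeff p i * poly (raising (monom 1 i)) x)" for x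
    by (simp add: poly_sum)
  then show ?thesis
    by (simp add: mono)
qed

text \<open>Every Hermite polynomial of positive index is a raising and so has mean zero; only the
  nonnegative multiples of \<open>hermite_poly 0 = 1\<close> contribute.\<close>

lemma gauss_integral_hermite_cone_nonneg:
  "p \<in> hermite_cone \<Longrightarrow> 0 \<le> (LINT x|gauss_measure. poly p x)"
proof (induction rule: hermite_cone.induct)
  case zero
  show ?case by simp
next
  case (add_term p a n)
  have "0 \<le> (LINT x|gauss_measure. poly (hermite_poly n) x)"
    by (cases n) (simp_all add: gauss_integral_raising)
  with add_term show ?case by simp
qed

section \<open>Integrability of products and the tangent inequality\<close>

lemma integrable_mult_of_square_integrable:
  fixes f h :: "'a \<Rightarrow> real"
  assumes [measurable]: "f \<in> borel_measurable \<mu>" "h \<in> borel_measurable \<mu>"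
    and "integrable \<mu> (\<lambda>x. (f x)\<^sup>2)" and "integrable \<mu> (\<lambda>x. (h x)\<^sup>2)"
  shows "integrable \<mu> (\<lambda>x. f x * h x)"
proof (rule Bochner_Integration.integrable_bound)
  show "integrable \<mu> (\<lambda>x. (f x)\<^sup>2 + (h x)\<^sup>2)"
    using assms by simp
  have "\<bar>f x * h x\<bar> \<le> (f x)\<^sup>2 + (h x)\<^sup>2" for x
  proof -
    have "2 * (\<bar>f x\<bar> * \<bar>h x\<bar>) \<le> (f x)\<^sup>2 + (h x)\<^sup>2"
      using sum_squares_bound[of "\<bar>f x\<bar>" "\<bar>h x\<bar>"] by simp
    moreover have "0 \<le> \<bar>f x\<bar> * \<bar>h x\<bar>"
      by simp
    ultimately show ?thesis
      unfolding abs_mult by linarith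
  qed
  then show "AE x in \<mu>. norm (f x * h x) \<le> norm ((f x)\<^sup>2 + (h x)\<^sup>2)"
    by simp
qed simp

lemma integrable_gauss_poly_square: "integrable gauss_measure (\<lambda>x. (poly p x)\<^sup>2)"
  by (simp flip: poly_power)

text \<open>For \<open>a\<close> nonzero this is \<open>a ^ n\<close> times Bernoulli's inequality
  at \<open>(b - a) / a\<close>, which holds at every real argument because \<open>n\<close> is
  even.\<close>

lemma power_above_tangent_even:
  fixes a b :: real
  assumes "even n" and "n > 0"
  shows "a ^ n + real n * ((b - a) * a ^ (n - 1)) \<le> b ^ n"
proof (cases "a = 0")
  case True
  \<comment> \<open>Evenness excludes \<open>n = 1\<close>, where \<open>a ^ (n - 1)\<close> would
    be \<open>0 ^ 0 = 1\<close>.\<close>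
  have "n - 1 \<noteq> 0"
    using assms by (cases "n = 1") auto
  then have "a ^ n = 0" and "a ^ (n - 1) = 0"
    using True assms(2) by (simp_all only: zero_power neq0_conv)
  then show ?thesis
    using assms(1) by (simp only: mult_zero_right add_0 zero_le_even_power)
next
  case False
  have an: "a ^ n = a * a ^ (n - 1)"
    using assms(2) by (simp flip: power_Suc)
  have "a ^ n * (1 + real n * ((b - a) / a)) \<le> a ^ n * (1 + (b - a) / a) ^ n"
    using assms by (intro mult_left_mono Bernoulli_inequality_even zero_le_even_power)
  also have "\<dots> = b ^ n"
    using False by (simp add: field_simps flip: power_mult_distrib)
  also have "a ^ n * (1 + real n * ((b - a) / a)) = a ^ n + real n * ((b - a) * a ^ (n - 1))"
    using False by (simp add: an field_simps)
  finally show ?thesis .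
qed

section \<open>Convergence of powers\<close>

theorem proposition3p1:
  fixes g :: "real \<Rightarrow> real" and c :: "nat \<Rightarrow> real" and M :: nat
  assumes "g \<in> Lp 2 gauss_measure"
    and "converges_in_Lp 2 gauss_measure (hermite_sum c) g"
    and "\<And>q. c q \<ge> 0"
    and "M \<ge> 1"
    and "g \<in> Lp (2 * M) gauss_measure"
  shows "converges_in_Lp 2 gauss_measure (\<lambda>N x. hermite_sum c N x ^ M) (\<lambda>x. g x ^ M)"
proof -

  \<comment> \<open>Truncations as polynomials in the cone, and integrability\<close>
  define P where "P N = (\<Sum>q\<le>N. smult (c q) (hermite_poly q))" for N
  have sum_eq: "hermite_sum c N = poly (P N)" for N
    by (simp add: fun_eq_iff hermite_sum_def P_def poly_sum hermite_eq_poly)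
  have P_cone: "P N \<in> hermite_cone" for N
    unfolding P_def
    by (intro hermite_cone_sum hermite_cone_smult hermite_cone_hermite_poly assms)
  have P_diff: "P n - P N \<in> hermite_cone" if "N \<le> n" for n N
  proof -
    have "P n - P N = (\<Sum>q\<in>{..n} - {..N}. smult (c q) (hermite_poly q))"
      unfolding P_def using that by (subst sum_diff) auto
    then show ?thesis
      by (simp add: hermite_cone_sum hermite_cone_smult hermite_cone_hermite_poly assms)
  qed
  have g_meas [measurable]: "g \<in> borel_measurable gauss_measure"
    using assms(1) by (simp add: Lp_def)
  have poly_meas [measurable]: "poly p \<in> borel_measurable gauss_measure" for p :: "real poly"
    by simp
  have g2: "integrable gauss_measure (\<lambda>x. (g x)\<^sup>2)"
    using assms(1) by (simp add: Lp_def)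
  have gM: "integrable gauss_measure (\<lambda>x. g x ^ (2 * M))"
    using assms(5) by (simp add: Lp_def power_even_abs)
  have gp: "integrable gauss_measure (\<lambda>x. g x * poly p x)" for p
    by (intro integrable_mult_of_square_integrable g2 integrable_gauss_poly_square) auto
  have dp: "integrable gauss_measure (\<lambda>x. (g x - poly q x) * poly p x)" for p q
    using gp[of p] by (simp add: left_diff_distrib flip: poly_mult)
  have d2: "integrable gauss_measure (\<lambda>x. (poly q x - g x)\<^sup>2)" for q
  proof -
    have "(poly q x - g x)\<^sup>2 = (poly q x)\<^sup>2 + (g x)\<^sup>2 - 2 * (g x * poly q x)" for x
      by (simp add: power2_diff)
    then show ?thesis
      using g2 gp[of q] integrable_gauss_poly_square[of q] by simp
  qed
  define d where "d N = (LINT x|gauss_measure. (poly (P N) x - g x)\<^sup>2)" for N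
  have d_lim: "d \<longlonglongrightarrow> 0"
  proof -
    have "(\<lambda>N. root 2 (d N)) \<longlonglongrightarrow> 0"
      using assms(2) by (simp add: converges_in_Lp_def Lp_norm_def sum_eq d_def)
    then have "(\<lambda>N. (root 2 (d N))\<^sup>2) \<longlonglongrightarrow> 0\<^sup>2"
      by (intro tendsto_power)
    moreover have "(root 2 (d N))\<^sup>2 = d N" for N
      by (simp add: d_def)
    ultimately show ?thesis by simp
  qed

  \<comment> \<open>Nonnegative pairing of the remainder with the cone\<close>
  have pairing: "0 \<le> (LINT x|gauss_measure. (g x - poly (P N) x) * poly p x)" (is "0 \<le> ?y")
    if p: "p \<in> hermite_cone" for N p
  proof -
    define B where "B = (LINT x|gauss_measure. (poly p x)\<^sup>2)"
    \<comment> \<open>A free parameter takes the place of the Cauchy-Schwarz inequality: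
      \<open>E[(g - P n + t p)^2]\<close> is nonnegative, \<open>n \<rightarrow> \<infinity>\<close>
      removes \<open>d n\<close>, and division by \<open>t\<close> leaves an error
      \<open>t * B\<close> that vanishes as \<open>t\<close> tends to 0 from the right.\<close>
    have bound: "- (t * B) \<le> 2 * ?y" if t: "t > 0" for t
    proof -
      have "- d n - t\<^sup>2 * B \<le> 2 * t * ?y" if n: "N \<le> n" for n
      proof -
        let ?u = "LINT x|gauss_measure. (g x - poly (P n) x) * poly p x"
        have "0 \<le> (LINT x|gauss_measure. ((g x - poly (P n) x) + t * poly p x)\<^sup>2)"
          by simp
        also have "\<dots> = (LINT x|gauss_measure. (poly (P n) x - g x)\<^sup>2 +
            2 * t * ((g x - poly (P n) x) * poly p x) + t\<^sup>2 * (poly p x)\<^sup>2)"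
          by (intro Bochner_Integration.integral_cong) (auto simp: power2_eq_square algebra_simps)
        also have "\<dots> = d n + 2 * t * ?u + t\<^sup>2 * B"
          using d2[of "P n"] dp[of "P n" p] integrable_gauss_poly_square[of p]
          by (simp add: d_def B_def)
        finally have 1: "- d n - t\<^sup>2 * B \<le> 2 * t * ?u" by simp
        \<comment> \<open>Positivity enters here: \<open>(P n - P N) * p\<close> lies in the cone,
          so \<open>?u\<close> is at most \<open>?y\<close>.\<close>
        have "?y - ?u = (LINT x|gauss_measure. poly ((P n - P N) * p) x)"
          using dp[of "P n" p] dp[of "P N" p]
          by (subst Bochner_Integration.integral_diff[symmetric])
             (auto simp: algebra_simps intro!: Bochner_Integration.integral_cong)
        also have "\<dots> \<ge> 0"
          by (intro gauss_integral_hermite_cone_nonneg hermite_cone_mult P_diff n p)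
        finally have "2 * t * ?u \<le> 2 * t * ?y"
          using t by simp
        with 1 show ?thesis by linarith
      qed
      moreover have "(\<lambda>n. - d n - t\<^sup>2 * B) \<longlonglongrightarrow> - 0 - t\<^sup>2 * B"
        by (intro tendsto_intros d_lim)
      ultimately have "- 0 - t\<^sup>2 * B \<le> 2 * t * ?y"
        by (intro LIMSEQ_le_const2) auto
      then have "t * (- (t * B)) \<le> t * (2 * ?y)"
        by (simp add: power2_eq_square mult.assoc mult.left_commute)
      then show ?thesis
        using t by (simp only: mult_le_cancel_left_pos)
    qed
    have "((\<lambda>t. - (t * B)) \<longlongrightarrow> - (0 * B)) (at_right 0)"
      by (intro tendsto_intros)
    then have "- (0 * B) \<le> 2 * ?y"
      by (rule tendsto_upperbound)
         (auto simp: eventually_at_right_less intro!: eventually_mono[OF eventually_at_right_less] bound)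
    then show ?thesis by simp
  qed

  \<comment> \<open>Uniform bound on the moments of order \<open>2 * M\<close>\<close>
  define e where "e N = (LINT x|gauss_measure. poly (P N) x ^ (2 * M))" for N
  have poly_pow: "integrable gauss_measure (\<lambda>x. poly p x ^ k)" for p k
    by (simp flip: poly_power)
  have e_le: "e N \<le> (LINT x|gauss_measure. g x ^ (2 * M))" for N
  proof -
    let ?Q = "P N ^ (2 * M - 1)"
    have "e N \<le> e N + real (2 * M) * (LINT x|gauss_measure. (g x - poly (P N) x) * poly ?Q x)"
      using pairing[of ?Q N] by (simp add: hermite_cone_power P_cone del: poly_power)
    also have "\<dots> = (LINT x|gauss_measure. poly (P N) x ^ (2 * M) +
        real (2 * M) * ((g x - poly (P N) x) * poly ?Q x))"
      using dp[of "P N" ?Q] poly_pow[of "P N" "2 * M"] by (simp add: e_def del: poly_power)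
    also have "\<dots> \<le> (LINT x|gauss_measure. g x ^ (2 * M))"
    proof (rule integral_mono)
      show "integrable gauss_measure (\<lambda>x. poly (P N) x ^ (2 * M) +
          real (2 * M) * ((g x - poly (P N) x) * poly ?Q x))"
        using dp[of "P N" ?Q] poly_pow[of "P N" "2 * M"] by (simp del: poly_power)
      show "poly (P N) x ^ (2 * M) + real (2 * M) * ((g x - poly (P N) x) * poly ?Q x)
          \<le> g x ^ (2 * M)" for x
        unfolding poly_power using assms(4) by (intro power_above_tangent_even) auto
    qed (rule gM)
    finally show ?thesis .
  qed

  \<comment> \<open>Distances between powers of truncations\<close>
  have dist_pow: "(LINT x|gauss_measure. (poly (P N) x ^ M - poly (P n) x ^ M)\<^sup>2) \<le> e n - e N"
    if "N \<le> n" for n N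
  proof -
    let ?D = "P N ^ M * (P n ^ M - P N ^ M)"
    have square: "(b - a)\<^sup>2 = a\<^sup>2 - b\<^sup>2 - 2 * (b * (a - b))" for a b :: real
      by algebra
    have "(poly (P N) x ^ M - poly (P n) x ^ M)\<^sup>2 =
        poly (P n) x ^ (2 * M) - poly (P N) x ^ (2 * M) - 2 * poly ?D x" for x
      unfolding square poly_mult poly_diff poly_power by (simp only: power_mult[symmetric] mult.commute[of M])
    then have "(LINT x|gauss_measure. (poly (P N) x ^ M - poly (P n) x ^ M)\<^sup>2) =
        (LINT x|gauss_measure. poly (P n) x ^ (2 * M) - poly (P N) x ^ (2 * M) - 2 * poly ?D x)"
      by (simp only:)
    also have "\<dots> = e n - e N - 2 * (LINT x|gauss_measure. poly ?D x)"
      using poly_pow integrable_gauss_poly[of ?D]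
      by (simp add: e_def del: poly_mult poly_diff poly_power)
    also have "\<dots> \<le> e n - e N"
      using gauss_integral_hermite_cone_nonneg[of ?D] that
      by (simp add: hermite_cone_mult hermite_cone_power hermite_cone_power_diff P_cone P_diff
          del: poly_mult poly_diff poly_power)
    finally show ?thesis .
  qed
  have e_mono: "incseq e"
  proof (rule monoI)
    fix m n :: nat
    assume "m \<le> n"
    have "0 \<le> (LINT x|gauss_measure. (poly (P m) x ^ M - poly (P n) x ^ M)\<^sup>2)" by simp
    with dist_pow[OF \<open>m \<le> n\<close>] show "e m \<le> e n" by linarith
  qed
  obtain L where L: "e \<longlonglongrightarrow> L" "\<And>n. e n \<le> L"
    using incseq_convergent[OF e_mono, of "LINT x|gauss_measure. g x ^ (2 * M)"] e_le by blast

  \<comment> \<open>Passage to the limit by Fatou's lemma\<close>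
  obtain r where r: "strict_mono r"
    and ae: "AE x in gauss_measure. (\<lambda>k. poly (P (r k)) x - g x) \<longlonglongrightarrow> 0"
    \<comment> \<open>The L1 statement is applied to the squared differences, whose L1 norms are
      \<open>d N\<close>; squares tend to 0 exactly where the differences do.\<close>
    using tendsto_L1_AE_subseq[of gauss_measure "\<lambda>N x. (poly (P N) x - g x)\<^sup>2"] d2 d_lim
    by (auto simp: d_def[abs_def])
  have fatou: "(\<integral>\<^sup>+x. ennreal ((poly (P N) x ^ M - g x ^ M)\<^sup>2) \<partial>gauss_measure) \<le> ennreal (L - e N)" for N
  proof -
    let ?u = "\<lambda>k x. ennreal ((poly (P N) x ^ M - poly (P (r k)) x ^ M)\<^sup>2)"
    have "(\<integral>\<^sup>+x. ennreal ((poly (P N) x ^ M - g x ^ M)\<^sup>2) \<partial>gauss_measure) =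
        (\<integral>\<^sup>+x. liminf (\<lambda>k. ?u k x) \<partial>gauss_measure)"
    proof (rule nn_integral_cong_AE, use ae in eventually_elim)
      case (elim x)
      then have "(\<lambda>k. poly (P (r k)) x) \<longlonglongrightarrow> g x"
        by (rule LIM_zero_cancel)
      then have "(\<lambda>k. ?u k x) \<longlonglongrightarrow> ennreal ((poly (P N) x ^ M - g x ^ M)\<^sup>2)"
        by (intro tendsto_intros)
      then show ?case
        using lim_imp_Liminf[OF sequentially_bot] by metis
    qed
    also have "\<dots> \<le> liminf (\<lambda>k. \<integral>\<^sup>+x. ?u k x \<partial>gauss_measure)"
      by (intro nn_integral_liminf) measurable
    also have "\<dots> \<le> ennreal (L - e N)"
    proof (rule Liminf_le)
      \<comment> \<open>As \<open>k \<le> r k\<close>, every \<open>k \<ge> N\<close> allows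
        \<open>dist_pow\<close> with \<open>r k\<close>, and \<open>e (r k) \<le> L\<close> makes
        the bound independent of \<open>k\<close>.\<close>
      have "(\<integral>\<^sup>+x. ?u k x \<partial>gauss_measure) \<le> ennreal (L - e N)" if "N \<le> k" for k
      proof -
        have "integrable gauss_measure (\<lambda>x. (poly (P N) x ^ M - poly (P (r k)) x ^ M)\<^sup>2)"
          by (simp flip: poly_power poly_diff)
        then have "(\<integral>\<^sup>+x. ?u k x \<partial>gauss_measure) =
            ennreal (LINT x|gauss_measure. (poly (P N) x ^ M - poly (P (r k)) x ^ M)\<^sup>2)"
          by (intro nn_integral_eq_integral) auto
        also have "N \<le> r k"
          using that seq_suble[OF r, of k] by simp
        then have "ennreal (LINT x|gauss_measure. (poly (P N) x ^ M - poly (P (r k)) x ^ M)\<^sup>2)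
            \<le> ennreal (L - e N)"
          using dist_pow[of N "r k"] L(2)[of "r k"] by (intro ennreal_leI) linarith
        finally show ?thesis .
      qed
      then show "\<forall>\<^sub>F k in sequentially. (\<integral>\<^sup>+x. ?u k x \<partial>gauss_measure) \<le> ennreal (L - e N)"
        by (auto simp: eventually_sequentially)
    qed simp
    finally show ?thesis .
  qed
  have dist_le: "(LINT x|gauss_measure. (poly (P N) x ^ M - g x ^ M)\<^sup>2) \<le> L - e N" for N
    using fatou[of N] L(2)[of N]
    by (subst integral_eq_nn_integral) (auto intro!: enn2real_leI)
  have "(\<lambda>N. LINT x|gauss_measure. (poly (P N) x ^ M - g x ^ M)\<^sup>2) \<longlonglongrightarrow> 0"
  proof (rule tendsto_sandwich[OF _ _ tendsto_const])
    show "(\<lambda>N. L - e N) \<longlonglongrightarrow> 0"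
      using tendsto_diff[OF tendsto_const[of L] L(1)] by simp
  qed (use dist_le in auto)
  then have "(\<lambda>N. root 2 (LINT x|gauss_measure. (poly (P N) x ^ M - g x ^ M)\<^sup>2)) \<longlonglongrightarrow> root 2 0"
    by (rule tendsto_real_root)
  moreover have "(\<lambda>x. poly (P N) x ^ M) \<in> Lp 2 gauss_measure" for N
    using poly_pow[of "P N" "M * 2"] by (simp add: Lp_def power_mult)
  moreover have "(\<lambda>x. g x ^ M) \<in> Lp 2 gauss_measure"
    using gM by (simp add: Lp_def power_mult mult.commute)
  ultimately show ?thesis
    by (simp add: converges_in_Lp_def Lp_norm_def sum_eq)
qed

end
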